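(* Let $\mathbb{F}$ be a field of characteristic $\neq 2$, let $h:\mathbb{F}[\sqrt t]^3\to\mathbb{F}[t]$ be the hermitian form $h(x_{-1},x_0,x_1)=x_{-1}\bar x_1+x_0\bar x_0+x_1\bar x_{-1}$, and let $\mathrm{SU}(h_{\mathbb{F}[t]})$ be the subgroup of $\mathrm{SL}_3(\mathbb{F}[\sqrt t])$ of matrices that preserve $h$. Consider the subgroups $$F:=\mathrm{SU}(h_{\mathbb{F}[t]})\cap\mathrm{GL}_3(\mathbb{F})\simeq\mathrm{SO}_3(\mathbb{F}),$$ $$\mathbb{T}:=\{\text{upper triangular matrices in }\mathrm{SU}(h_{\mathbb{F}[t]})\}=\left\{\begin{pmatrix}c&-\bar x&c^{-1}y\\0&1&c^{-1}x\\0&0&c^{-1}\end{pmatrix}:\ c\in\mathbb{F}^*=\mathbb{F}[\sqrt t]^*,\ x,y\in\mathbb{F}[\sqrt t],\ N(x)+T(y)=0\right\}.$$ Then $\mathrm{SU}(h_{\mathbb{F}[t]})$ is the sum of the groups $F$ and $\mathbb{T}$ amalgamated along their intersection.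
   Context: Here $t$ is an indeterminate, $x\mapsto\bar x$ is the $\mathbb{F}[t]$-algebra involution of $\mathbb{F}[\sqrt t]$ sending $\sqrt t$ to $-\sqrt t$, $N(x)=x\bar x$ and $T(y)=y+\bar y$. $\mathrm{SO}_3(\mathbb{F})$ is the special orthogonal group of the quadratic form $h|_{\mathbb{F}^3}$, $(x_{-1},x_0,x_1)\mapsto 2x_{-1}x_1+x_0^2$. *)

theory Defs
  imports "HOL-Analysis.Analysis" "HOL-Algebra.Group"
    "HOL-Computational_Algebra.Polynomial"
begin

text \<open>The ring \<open>\<F>[\<surd>t]\<close> is the polynomial ring in the variable \<open>s = \<surd>t\<close>, so it is
  rendered by the type \<open>'a poly\<close>; \<open>\<F>[t]\<close> is the subring of polynomials in \<open>t = s\<^sup>2\<close>.\<close>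

definition sqrt_t :: "'a::field poly" where
  "sqrt_t = [:0, 1:]"

definition Ft :: "'a::field poly set" where
  "Ft = range (\<lambda>q. q \<circ>\<^sub>p (sqrt_t ^ 2))"

definition bar :: "'a::field poly \<Rightarrow> 'a poly" where
  "bar p = p \<circ>\<^sub>p (- sqrt_t)"

lemma bar_sqrt_t: "bar sqrt_t = - sqrt_t"
  by (simp add: bar_def sqrt_t_def pcompose_pCons)

lemma bar_add: "bar (p + q) = bar p + bar q"
  by (simp add: bar_def pcompose_add)

lemma bar_mult: "bar (p * q) = bar p * bar q"
  by (simp add: bar_def pcompose_mult)

lemma bar_bar: "bar (bar p) = p"
  by (simp add: bar_def pcompose_assoc[symmetric] pcompose_uminus sqrt_t_def pcompose_pCons)

lemma bar_Ft: "p \<in> Ft \<Longrightarrow> bar p = p"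
  by (auto simp: Ft_def bar_def pcompose_assoc[symmetric] pcompose_mult power2_eq_square
      sqrt_t_def pcompose_pCons)

definition Nm :: "'a::field poly \<Rightarrow> 'a poly" where
  "Nm x = x * bar x"

definition Tr :: "'a::field poly \<Rightarrow> 'a poly" where
  "Tr y = y + bar y"

text \<open>The coordinates \<open>x\<^bsub>-1\<^esub>, x\<^sub>0, x\<^sub>1\<close> of a triple are the components 1, 2, 3 of a vector
  indexed by the type \<^typ>\<open>3\<close>.\<close>

definition herm :: "'a::field poly ^ 3 \<Rightarrow> 'a poly" where
  "herm v = v $ 1 * bar (v $ 3) + v $ 2 * bar (v $ 2) + v $ 3 * bar (v $ 1)"

lemma even_odd_decomp:
  "\<exists>a b. (p :: 'a::field poly) = a \<circ>\<^sub>p (sqrt_t ^ 2) + sqrt_t * (b \<circ>\<^sub>p (sqrt_t ^ 2))"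
proof (induction p)
  case 0
  show ?case by (intro exI[of _ 0]) simp
next
  case (pCons c p)
  then obtain a b where p: "p = a \<circ>\<^sub>p (sqrt_t ^ 2) + sqrt_t * (b \<circ>\<^sub>p (sqrt_t ^ 2))" by blast
  have c: "pCons c p = [:c:] + sqrt_t * p" by (simp add: sqrt_t_def)
  have "pCons c p = pCons c b \<circ>\<^sub>p (sqrt_t ^ 2) + sqrt_t * (a \<circ>\<^sub>p (sqrt_t ^ 2))"
    unfolding c by (subst p) (simp add: pcompose_pCons algebra_simps power2_eq_square)
  then show ?case by blast
qed

lemma Ft_iff_bar:
  assumes "CHAR('a::field) \<noteq> 2"
  shows "(p :: 'a poly) \<in> Ft \<longleftrightarrow> bar p = p"
proof
  assume *: "bar p = p"
  obtain a b where p: "p = a \<circ>\<^sub>p (sqrt_t ^ 2) + sqrt_t * (b \<circ>\<^sub>p (sqrt_t ^ 2))"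
    using even_odd_decomp by blast
  have even: "bar (q \<circ>\<^sub>p (sqrt_t ^ 2)) = q \<circ>\<^sub>p (sqrt_t ^ 2)" for q :: "'a poly"
    by (rule bar_Ft) (simp add: Ft_def)
  have "bar p = a \<circ>\<^sub>p (sqrt_t ^ 2) - sqrt_t * (b \<circ>\<^sub>p (sqrt_t ^ 2))"
    by (subst p) (simp add: bar_add bar_mult even bar_sqrt_t)
  hence "p - bar p = smult 2 (sqrt_t * (b \<circ>\<^sub>p (sqrt_t ^ 2)))"
    using p smult_add_left[of 1 1 "sqrt_t * (b \<circ>\<^sub>p (sqrt_t ^ 2))"] by simp
  hence "smult 2 (sqrt_t * (b \<circ>\<^sub>p (sqrt_t ^ 2))) = 0"
    using * by simp
  moreover have "(2 :: 'a) \<noteq> 0"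
  proof
    assume "(2 :: 'a) = 0"
    hence "of_nat 2 = (0 :: 'a)" by simp
    hence "CHAR('a) dvd 2" by (simp only: of_nat_eq_0_iff_char_dvd)
    hence "CHAR('a) \<le> 2" "CHAR('a) \<noteq> 0"
      using dvd_imp_le[of "CHAR('a)" 2] dvd_0_left_iff[of "2 :: nat"] by fastforce+
    moreover have "CHAR('a) \<noteq> 1" by simp
    ultimately show False using assms by linarith
  qed
  ultimately have "sqrt_t * (b \<circ>\<^sub>p (sqrt_t ^ 2)) = 0" by simp
  hence "p = a \<circ>\<^sub>p (sqrt_t ^ 2)" using p by (simp only: add_0_right)
  thus "p \<in> Ft" by (simp add: Ft_def)
qed (rule bar_Ft)

lemma herm_in_Ft: "CHAR('a::field) \<noteq> 2 \<Longrightarrow> herm (v :: 'a poly ^ 3) \<in> Ft"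
  by (simp add: Ft_iff_bar herm_def bar_add bar_mult bar_bar algebra_simps)

definition qform :: "'a::field ^ 3 \<Rightarrow> 'a" where
  "qform v = 2 * (v $ 1) * (v $ 3) + (v $ 2)\<^sup>2"

definition SL3 :: "('r::comm_ring_1 ^ 3 ^ 3) monoid" where
  "SL3 = \<lparr>carrier = {A. det A = 1}, mult = (**), one = mat 1\<rparr>"

definition SU :: "('a::field poly ^ 3 ^ 3) set" where
  "SU = {A \<in> carrier SL3. \<forall>v. herm (A *v v) = herm v}"

definition SO3 :: "('a::field ^ 3 ^ 3) set" where
  "SO3 = {A \<in> carrier SL3. \<forall>v. qform (A *v v) = qform v}"

definition const_mat :: "'a::field ^ 3 ^ 3 \<Rightarrow> 'a poly ^ 3 ^ 3" where
  "const_mat A = map_matrix (\<lambda>c. [:c:]) A"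

definition GL3_const :: "('a::field poly ^ 3 ^ 3) set" where
  "GL3_const = const_mat ` {A. invertible A}"

definition Fgrp :: "('a::field poly ^ 3 ^ 3) set" where
  "Fgrp = SU \<inter> GL3_const"

text \<open>Triangularity is spelled out entrywise: in the order of the type \<^typ>\<open>3\<close> the index
  \<open>3 = 0\<close> comes before \<open>1\<close>.\<close>

definition upper_triangular3 :: "'r::zero ^ 3 ^ 3 \<Rightarrow> bool" where
  "upper_triangular3 A \<longleftrightarrow> A $ 2 $ 1 = 0 \<and> A $ 3 $ 1 = 0 \<and> A $ 3 $ 2 = 0"

definition Tgrp :: "('a::field poly ^ 3 ^ 3) set" where
  "Tgrp = {A \<in> SU. upper_triangular3 A}"

definition tri_mat :: "'a::field \<Rightarrow> 'a poly \<Rightarrow> 'a poly \<Rightarrow> 'a poly ^ 3 ^ 3" where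
  "tri_mat c x y = vector
     [vector [[:c:], - bar x, [:inverse c:] * y],
      vector [0,     1,       [:inverse c:] * x],
      vector [0,     0,       [:inverse c:]]]"

text \<open>\<open>G\<close> is the sum (pushout) of its subgroups \<open>A\<close> and \<open>B\<close> amalgamated along \<open>A \<inter> B\<close>.
  The test groups \<open>H\<close> have elements in the type \<open>'h\<close>; the universal property among all
  groups is the assertion of this predicate for an arbitrary type variable \<open>'h\<close>. Requiring
  \<open>k\<close> to be extensional only fixes its irrelevant values outside \<open>carrier G\<close>.\<close>

definition amalgamated_sum ::
    "('g, 'm) monoid_scheme \<Rightarrow> 'g set \<Rightarrow> 'g set \<Rightarrow> 'h itself \<Rightarrow> bool" where
  "amalgamated_sum G A B (_ :: 'h itself) \<longleftrightarrow>
     group G \<and> subgroup A G \<and> subgroup B G \<and>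
     (\<forall>(H :: 'h monoid) f g.
        group H \<and> f \<in> hom (G\<lparr>carrier := A\<rparr>) H \<and> g \<in> hom (G\<lparr>carrier := B\<rparr>) H \<and>
        (\<forall>x \<in> A \<inter> B. f x = g x) \<longrightarrow>
        (\<exists>!k. k \<in> hom G H \<and> k \<in> extensional (carrier G) \<and>
              (\<forall>x \<in> A. k x = f x) \<and> (\<forall>x \<in> B. k x = g x)))"

end

(* Write w for the antidiagonal matrix with entries 1, -1, 1. Everything is read off the first
   column (v1, v2, v3) of a matrix, which is isotropic for h; v3 = 0 means that the matrix lies
   in T. Euclidean division by v3 lets an element of T bring v1 and v2 below the degree of v3:
   isotropy forces the quotient of v1 by v3 to be skew, so that the required matrix is in SU.
   Multiplying by w afterwards lowers the degree of v3. Hence F and T generate, and for constant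
   matrices the same step is the Bruhat decomposition of F with respect to F \<inter> T.
   Conversely an entry y of an element of T outside F has positive degree, larger than that of x,
   since N(x) + T(y) = 0 and deg N(x) = 2 deg x. So each factor w t with t in T - F raises deg v3
   while v3 keeps the maximal degree, and no reduced word w t1 w t2 ... w tn lies in T.
   The universal property follows: for f and g that agree on F \<inter> T, the subgroup of G x H generated
   by the graphs of f and g consists of reduced words, so by the previous remark it meets
   1 x H trivially and is the graph of the required homomorphism. *)
theory Submission
  imports Defs "HOL-Algebra.Generated_Groups"
begin

section \<open>A ping-pong criterion for amalgamated sums\<close>

text \<open>These are the products w c1 w c2 ... w t. Only the final letter ranges over all of T;
  the inner letters come from C, later the part of T outside the other factor, so that no two
  letters w can be merged.\<close>

inductive_set reduced_words :: "('k, 'm) monoid_scheme \<Rightarrow> 'k \<Rightarrow> 'k set \<Rightarrow> 'k set \<Rightarrow> 'k set"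
  for K (structure) and w and T and C where
    last: "t \<in> T \<Longrightarrow> w \<otimes> t \<in> reduced_words K w T C"
  | step: "c \<in> C \<Longrightarrow> p \<in> reduced_words K w T C \<Longrightarrow> w \<otimes> (c \<otimes> p) \<in> reduced_words K w T C"

lemma (in group) reduced_words_closed:
  assumes "w \<in> carrier G" "T \<subseteq> carrier G" "C \<subseteq> carrier G" "p \<in> reduced_words G w T C"
  shows "p \<in> carrier G"
  using assms(4) by induction (use assms(1-3) in auto)

text \<open>Since S is closed under inverses, every clause of \<open>generate\<close> reduces to
  left multiplication by S. With R a set of normal forms that contains the identity, this confines
  the generated group to R.\<close>

lemma (in group) generate_mult_mem:
  assumes "x \<in> generate G S" "S \<subseteq> carrier G" "R \<subseteq> carrier G"
    and "\<And>s p. s \<in> S \<Longrightarrow> p \<in> R \<Longrightarrow> s \<otimes> p \<in> R"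
    and "\<And>s. s \<in> S \<Longrightarrow> inv s \<in> S"
    and "p \<in> R"
  shows "x \<otimes> p \<in> R"
  using assms(1,6)
proof (induction arbitrary: p)
  case one
  then show ?case using assms(3) by auto
next
  case (incl h)
  then show ?case using assms(4) by blast
next
  case (inv h)
  then show ?case using assms(4,5) by blast
next
  case (eng h1 h2)
  have "h1 \<in> carrier G" "h2 \<in> carrier G" "p \<in> carrier G"
    using eng generate_in_carrier[OF assms(2)] assms(3) by auto
  then show ?case using eng by (simp add: m_assoc)
qed

lemma (in group) hom_eq_on_generate:
  assumes "group H" "k \<in> hom G H" "k' \<in> hom G H" "S \<subseteq> carrier G"
    and "\<And>s. s \<in> S \<Longrightarrow> k s = k' s" and "x \<in> generate G S"
  shows "k x = k' x"
proof -
  interpret k: group_hom G H k using assms(1,2) by (simp add: group_hom_def group_hom_axioms_def)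
  interpret k': group_hom G H k' using assms(1,3) by (simp add: group_hom_def group_hom_axioms_def)
  show ?thesis using assms(6)
  proof induction
    case (inv h)
    then show ?case using assms(4,5) by (metis k.hom_inv k'.hom_inv subsetD)
  next
    case (eng h1 h2)
    then show ?case using generate_in_carrier[OF assms(4)] by simp
  qed (use assms(5) in auto)
qed

text \<open>Each hypothesis has one task: \<open>bruhat\<close> splits A into A \<inter> B and one
  double coset, \<open>descent\<close> lowers the height \<open>\<mu>\<close> and yields generation,
  and \<open>\<Omega>\<close> is a ping-pong set that receives every reduced word and misses
  B.\<close>

locale amalgam_data = group G for G (structure) +
  fixes A B \<Omega> :: "'a set" and w :: 'a and \<mu> :: "'a \<Rightarrow> nat"
  assumes A: "subgroup A G" and B: "subgroup B G" and wA: "w \<in> A"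
    and bruhat: "x \<in> A \<Longrightarrow> x \<notin> B \<Longrightarrow> \<exists>u \<in> A \<inter> B. \<exists>v \<in> A \<inter> B. x = u \<otimes> (w \<otimes> v)"
    and descent: "x \<in> carrier G \<Longrightarrow> x \<notin> B \<Longrightarrow> \<exists>t \<in> B. \<mu> (w \<otimes> (t \<otimes> x)) < \<mu> x"
    and pp_last: "t \<in> B \<Longrightarrow> w \<otimes> t \<in> \<Omega>"
    and pp_step: "t \<in> B \<Longrightarrow> t \<notin> A \<Longrightarrow> p \<in> \<Omega> \<Longrightarrow> w \<otimes> (t \<otimes> p) \<in> \<Omega>"
    and pp_disj: "\<Omega> \<inter> B = {}"
begin

lemma A_carrier: "x \<in> A \<Longrightarrow> x \<in> carrier G" and B_carrier: "x \<in> B \<Longrightarrow> x \<in> carrier G"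
  using A B by (auto dest: subgroup.mem_carrier)

text \<open>Induction on \<open>\<mu>\<close>: outside B, \<open>descent\<close> gives an element w
  t x of smaller height, and x is recovered from it by multiplying with the inverses of w and
  t.\<close>

lemma generate_eq: "x \<in> carrier G \<Longrightarrow> x \<in> generate G (A \<union> B)"
proof (induction "\<mu> x" arbitrary: x rule: less_induct)
  case less
  show ?case
  proof (cases "x \<in> B")
    case True
    then show ?thesis by (auto intro: generate.incl)
  next
    case False
    then obtain t where t: "t \<in> B" "\<mu> (w \<otimes> (t \<otimes> x)) < \<mu> x"
      using descent less.prems by blast
    have c: "t \<in> carrier G" "w \<in> carrier G" using t wA A_carrier B_carrier by auto
    have "w \<otimes> (t \<otimes> x) \<in> generate G (A \<union> B)"
      using less c t by simp
    moreover have "inv w \<in> generate G (A \<union> B)" "inv t \<in> generate G (A \<union> B)"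
      using t wA by (auto intro: generate.inv)
    ultimately have "inv t \<otimes> (inv w \<otimes> (w \<otimes> (t \<otimes> x))) \<in> generate G (A \<union> B)"
      by (blast intro: generate.eng)
    also have "inv t \<otimes> (inv w \<otimes> (w \<otimes> (t \<otimes> x))) = x"
      using c less.prems by (simp add: m_assoc[symmetric])
    finally show ?thesis .
  qed
qed

end

section \<open>The universal property via graphs in the product group\<close>

locale amalgam_cocone = amalgam_data G A B \<Omega> w \<mu> + H: group H
  for G (structure) and A B \<Omega> w \<mu> and H (structure) +
  fixes f g
  assumes f: "f \<in> hom (G\<lparr>carrier := A\<rparr>) H" and g: "g \<in> hom (G\<lparr>carrier := B\<rparr>) H"
    and fg: "x \<in> A \<Longrightarrow> x \<in> B \<Longrightarrow> f x = g x"
begin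

abbreviation "K \<equiv> G \<times>\<times> H"
text \<open>The images of \<open>pair_A\<close> and \<open>pair_B\<close> are the graphs of f and g.
  The common extension of f and g is sought as the subgroup of the product that they
  generate.\<close>

definition "pair_A = (\<lambda>x. (x, f x))"
definition "pair_B = (\<lambda>x. (x, g x))"

sublocale K: group K
  by (rule DirProd_group) unfold_locales

lemma pair_A_closed: "x \<in> A \<Longrightarrow> pair_A x \<in> carrier K"
  and pair_A_mult: "x \<in> A \<Longrightarrow> y \<in> A \<Longrightarrow> pair_A (x \<otimes> y) = pair_A x \<otimes>\<^bsub>K\<^esub> pair_A y"
  using f A_carrier by (auto simp: pair_A_def hom_def)

lemma pair_B_closed: "x \<in> B \<Longrightarrow> pair_B x \<in> carrier K"
  and pair_B_mult: "x \<in> B \<Longrightarrow> y \<in> B \<Longrightarrow> pair_B (x \<otimes> y) = pair_B x \<otimes>\<^bsub>K\<^esub> pair_B y"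
  using g B_carrier by (auto simp: pair_B_def hom_def)

lemma pair_A_eq_pair_B: "x \<in> A \<Longrightarrow> x \<in> B \<Longrightarrow> pair_A x = pair_B x"
  using fg by (simp add: pair_A_def pair_B_def)

lemma pair_A_inv: assumes "x \<in> A" shows "inv\<^bsub>K\<^esub> (pair_A x) = pair_A (inv x)"
proof (rule K.inv_equality)
  have i: "inv x \<in> A" using assms A by (simp add: subgroup.m_inv_closed)
  interpret group_hom "G\<lparr>carrier := A\<rparr>" H f
    using f A by (simp add: group_hom_def group_hom_axioms_def subgroup_imp_group H.is_group)
  have "pair_A (inv x) \<otimes>\<^bsub>K\<^esub> pair_A x = pair_A \<one>"
    using i assms A_carrier by (simp flip: pair_A_mult)
  then show "pair_A (inv x) \<otimes>\<^bsub>K\<^esub> pair_A x = \<one>\<^bsub>K\<^esub>" using hom_one by (simp add: pair_A_def)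
  show "pair_A x \<in> carrier K" "pair_A (inv x) \<in> carrier K" using assms i pair_A_closed by auto
qed

lemma pair_B_inv: assumes "x \<in> B" shows "inv\<^bsub>K\<^esub> (pair_B x) = pair_B (inv x)"
proof (rule K.inv_equality)
  have i: "inv x \<in> B" using assms B by (simp add: subgroup.m_inv_closed)
  interpret group_hom "G\<lparr>carrier := B\<rparr>" H g
    using g B by (simp add: group_hom_def group_hom_axioms_def subgroup_imp_group H.is_group)
  have "pair_B (inv x) \<otimes>\<^bsub>K\<^esub> pair_B x = pair_B \<one>"
    using i assms B_carrier by (simp flip: pair_B_mult)
  then show "pair_B (inv x) \<otimes>\<^bsub>K\<^esub> pair_B x = \<one>\<^bsub>K\<^esub>" using hom_one by (simp add: pair_B_def)
  show "pair_B x \<in> carrier K" "pair_B (inv x) \<in> carrier K" using assms i pair_B_closed by auto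
qed

lemma pair_B_one: "pair_B \<one> = \<one>\<^bsub>K\<^esub>"
proof -
  interpret group_hom "G\<lparr>carrier := B\<rparr>" H g
    using g B by (simp add: group_hom_def group_hom_axioms_def subgroup_imp_group H.is_group)
  show ?thesis using hom_one by (simp add: pair_B_def)
qed

abbreviation "words \<equiv> reduced_words K (pair_A w) (pair_B ` B) (pair_B ` (B - A))"
text \<open>Words start with w, so a leading factor from B has to be allowed, and B alone covers the
  elements without any w. The set is designed to be stable under left multiplication by both
  graphs.\<close>

definition "normal_forms = pair_B ` B \<union> {pair_B t \<otimes>\<^bsub>K\<^esub> r |t r. t \<in> B \<and> r \<in> words}"

lemma words_closed: "r \<in> words \<Longrightarrow> r \<in> carrier K"
  by (rule K.reduced_words_closed[of "pair_A w" "pair_B ` B" "pair_B ` (B - A)"])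
    (auto simp del: carrier_DirProd simp: pair_A_closed wA pair_B_closed)

lemma normal_forms_closed: "normal_forms \<subseteq> carrier K"
  by (auto simp: normal_forms_def pair_B_closed words_closed simp del: carrier_DirProd)

lemma words_nf: assumes "r \<in> words" shows "r \<in> normal_forms"
proof -
  have "r = pair_B \<one> \<otimes>\<^bsub>K\<^esub> r" using words_closed[OF assms] K.l_one pair_B_one by (simp del: one_DirProd)
  then show ?thesis unfolding normal_forms_def using assms subgroup.one_closed[OF B] by blast
qed

lemma pair_B_nf: assumes "t \<in> B" "p \<in> normal_forms" shows "pair_B t \<otimes>\<^bsub>K\<^esub> p \<in> normal_forms"
  using assms(2) unfolding normal_forms_def
proof (elim UnE imageE CollectE exE conjE)
  fix s assume "p = pair_B s" "s \<in> B"
  then show "pair_B t \<otimes>\<^bsub>K\<^esub> p \<in> pair_B ` B \<union> {pair_B t \<otimes>\<^bsub>K\<^esub> r |t r. t \<in> B \<and> r \<in> words}"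
    using assms(1) by (simp flip: pair_B_mult add: subgroup.m_closed[OF B])
next
  fix s r assume p: "p = pair_B s \<otimes>\<^bsub>K\<^esub> r" "s \<in> B" "r \<in> words"
  then have "pair_B t \<otimes>\<^bsub>K\<^esub> p = pair_B (t \<otimes> s) \<otimes>\<^bsub>K\<^esub> r"
    using assms(1) pair_B_closed words_closed by (simp only: pair_B_mult K.m_assoc)
  then show "pair_B t \<otimes>\<^bsub>K\<^esub> p \<in> pair_B ` B \<union> {pair_B t \<otimes>\<^bsub>K\<^esub> r |t r. t \<in> B \<and> r \<in> words}"
    using assms(1) p(2,3) subgroup.m_closed[OF B, of t s] by blast
qed

text \<open>This is the delicate half of the stability: when the leading letter from B also lies in
  A, prefixing w does not give a reduced word, and \<open>bruhat\<close> has to restore the normal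
  form.\<close>

lemma w_nf: assumes "p \<in> normal_forms" shows "pair_A w \<otimes>\<^bsub>K\<^esub> p \<in> normal_forms"
  using assms unfolding normal_forms_def
proof (fold normal_forms_def, elim UnE imageE CollectE exE conjE)
  fix s assume "p = pair_B s" "s \<in> B"
  then show ?thesis by (auto intro: words_nf reduced_words.last)
next
  fix t r assume p: "p = pair_B t \<otimes>\<^bsub>K\<^esub> r" "t \<in> B" "r \<in> words"
  show ?thesis
  proof (cases "t \<in> A")
    case False
    then show ?thesis using p by (auto intro: words_nf reduced_words.step)
  next
    case tA: True
    txt \<open>Here \<open>w t w\<close> lies in \<open>A\<close>, so that two letters \<open>w\<close> of the word collapse to none or to one;
      the next letter then changes only by a factor from \<open>A \<inter> B\<close>.\<close>
    have "\<exists>s. r = pair_A w \<otimes>\<^bsub>K\<^esub> s \<and> s \<in> carrier K \<and> s \<in> normal_forms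
        \<and> (\<forall>b \<in> A \<inter> B. pair_A w \<otimes>\<^bsub>K\<^esub> (pair_B b \<otimes>\<^bsub>K\<^esub> s) \<in> words)"
      using p(3)
    proof cases
      case (last t1)
      then obtain x where x: "t1 = pair_B x" "x \<in> B" by blast
      have "pair_A w \<otimes>\<^bsub>K\<^esub> (pair_B b \<otimes>\<^bsub>K\<^esub> t1) \<in> words" if "b \<in> A \<inter> B" for b
        using that x subgroup.m_closed[OF B, of b x]
        by (auto simp flip: pair_B_mult intro: reduced_words.last)
      moreover have "t1 \<in> normal_forms" "t1 \<in> carrier K" using x pair_B_closed by (auto simp: normal_forms_def)
      ultimately show ?thesis using last(1) by blast
    next
      case (step c q)
      then obtain x where x: "c = pair_B x" "x \<in> B" "x \<notin> A" by blast
      have "pair_A w \<otimes>\<^bsub>K\<^esub> (pair_B b \<otimes>\<^bsub>K\<^esub> (c \<otimes>\<^bsub>K\<^esub> q)) \<in> words" if b: "b \<in> A \<inter> B" for b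
      proof -
        have "b \<otimes> x \<in> B" using b x subgroup.m_closed[OF B] by auto
        moreover have "b \<otimes> x \<notin> A"
        proof
          assume "b \<otimes> x \<in> A"
          then have "inv b \<otimes> (b \<otimes> x) \<in> A"
            using b by (simp add: subgroup.m_closed[OF A] subgroup.m_inv_closed[OF A])
          then show False using b x B_carrier by (simp add: m_assoc[symmetric])
        qed
        ultimately have "pair_A w \<otimes>\<^bsub>K\<^esub> (pair_B (b \<otimes> x) \<otimes>\<^bsub>K\<^esub> q) \<in> words"
          using step(3) by (auto intro: reduced_words.step)
        also have "pair_B (b \<otimes> x) \<otimes>\<^bsub>K\<^esub> q = pair_B b \<otimes>\<^bsub>K\<^esub> (c \<otimes>\<^bsub>K\<^esub> q)"
          using b x(1,2) step(3) pair_B_closed words_closed by (simp add: pair_B_mult K.m_assoc)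
        finally show ?thesis .
      qed
      moreover have "c \<otimes>\<^bsub>K\<^esub> q \<in> normal_forms" using x(1,2) step(3) unfolding normal_forms_def by blast
      moreover have "c \<otimes>\<^bsub>K\<^esub> q \<in> carrier K" using x(1,2) step(3) pair_B_closed words_closed by blast
      ultimately show ?thesis using step(1) by blast
    qed
    then obtain s where s: "r = pair_A w \<otimes>\<^bsub>K\<^esub> s" "s \<in> carrier K" "s \<in> normal_forms"
      "\<And>b. b \<in> A \<Longrightarrow> b \<in> B \<Longrightarrow> pair_A w \<otimes>\<^bsub>K\<^esub> (pair_B b \<otimes>\<^bsub>K\<^esub> s) \<in> words" by blast
    define a where "a = w \<otimes> (t \<otimes> w)"
    have a: "a \<in> A" unfolding a_def using wA tA A by (simp add: subgroup.m_closed)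
    have "pair_A w \<otimes>\<^bsub>K\<^esub> p = pair_A w \<otimes>\<^bsub>K\<^esub> (pair_A t \<otimes>\<^bsub>K\<^esub> (pair_A w \<otimes>\<^bsub>K\<^esub> s))"
      by (simp only: p(1) s(1) pair_A_eq_pair_B[OF tA p(2)])
    also have "\<dots> = pair_A a \<otimes>\<^bsub>K\<^esub> s"
      unfolding a_def using wA tA pair_A_closed s(2) subgroup.m_closed[OF A]
      by (simp only: pair_A_mult K.m_assoc K.m_closed)
    finally have *: "pair_A w \<otimes>\<^bsub>K\<^esub> p = pair_A a \<otimes>\<^bsub>K\<^esub> s" .
    show ?thesis
    proof (cases "a \<in> B")
      case True
      then show ?thesis using * a s(3) pair_A_eq_pair_B pair_B_nf by simp
    next
      case False
      then obtain u v where uv: "u \<in> A" "u \<in> B" "v \<in> A" "v \<in> B" "a = u \<otimes> (w \<otimes> v)"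
        using bruhat a by blast
      have "pair_A a \<otimes>\<^bsub>K\<^esub> s = pair_A u \<otimes>\<^bsub>K\<^esub> (pair_A w \<otimes>\<^bsub>K\<^esub> (pair_A v \<otimes>\<^bsub>K\<^esub> s))"
        unfolding uv(5) using uv wA pair_A_closed s(2) subgroup.m_closed[OF A]
        by (simp only: pair_A_mult K.m_assoc K.m_closed)
      then show ?thesis using * uv pair_A_eq_pair_B pair_B_nf s(4) words_nf by simp
    qed
  qed
qed

text \<open>By \<open>bruhat\<close>, multiplication by an element of A is composed of
  multiplications by w and by elements of A \<inter> B, which are settled already.\<close>

lemma pair_A_nf: assumes "a \<in> A" "p \<in> normal_forms" shows "pair_A a \<otimes>\<^bsub>K\<^esub> p \<in> normal_forms"
proof (cases "a \<in> B")
  case True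
  then show ?thesis using assms pair_A_eq_pair_B pair_B_nf by simp
next
  case False
  then obtain u v where uv: "u \<in> A" "u \<in> B" "v \<in> A" "v \<in> B" "a = u \<otimes> (w \<otimes> v)"
    using bruhat assms by blast
  have "p \<in> carrier K" using assms normal_forms_closed by blast
  then have "pair_A a \<otimes>\<^bsub>K\<^esub> p = pair_A u \<otimes>\<^bsub>K\<^esub> (pair_A w \<otimes>\<^bsub>K\<^esub> (pair_A v \<otimes>\<^bsub>K\<^esub> p))"
    unfolding uv(5) using uv wA pair_A_closed subgroup.m_closed[OF A]
    by (simp only: pair_A_mult K.m_assoc K.m_closed)
  then show ?thesis using uv pair_A_eq_pair_B pair_B_nf w_nf assms(2) by simp
qed

lemma fst_words: "r \<in> words \<Longrightarrow> fst r \<in> \<Omega>"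
proof (induction rule: reduced_words.induct)
  case (last t)
  then show ?case using pp_last by (auto simp: pair_A_def pair_B_def)
next
  case (step c p)
  then show ?case using pp_step by (auto simp: pair_A_def pair_B_def mult_DirProd')
qed

text \<open>This subgroup turns out to be the graph of the required homomorphism:
  \<open>\<Gamma>_total\<close> and \<open>\<Gamma>_unique\<close> show that it has exactly one
  point over each element of G.\<close>

definition "\<Gamma> = generate K (pair_A ` A \<union> pair_B ` B)"

lemma gen_closed: "pair_A ` A \<union> pair_B ` B \<subseteq> carrier K"
  using pair_A_closed pair_B_closed by blast

lemma \<Gamma>_subgroup: "subgroup \<Gamma> K"
  unfolding \<Gamma>_def using gen_closed by (rule K.generate_is_subgroup)

lemma \<Gamma>_nf: assumes "x \<in> \<Gamma>" shows "x \<in> normal_forms"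
proof -
  have "\<one>\<^bsub>K\<^esub> \<in> normal_forms" using pair_B_one subgroup.one_closed[OF B] unfolding normal_forms_def by force
  moreover have "inv\<^bsub>K\<^esub> s \<in> pair_A ` A \<union> pair_B ` B" if "s \<in> pair_A ` A \<union> pair_B ` B" for s
    using that pair_A_inv pair_B_inv subgroup.m_inv_closed[OF A] subgroup.m_inv_closed[OF B] by auto
  ultimately have "x \<otimes>\<^bsub>K\<^esub> \<one>\<^bsub>K\<^esub> \<in> normal_forms"
    using K.generate_mult_mem[OF assms[unfolded \<Gamma>_def] gen_closed normal_forms_closed] pair_A_nf pair_B_nf by blast
  then show ?thesis
    using assms subgroup.mem_carrier[OF \<Gamma>_subgroup] K.r_one by metis
qed

text \<open>By the ping-pong hypotheses a reduced word that contains \<open>w\<close> lies outside \<open>B\<close>.\<close>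

lemma \<Gamma>_one: assumes "(\<one>, h) \<in> \<Gamma>" shows "h = \<one>\<^bsub>H\<^esub>"
  using \<Gamma>_nf[OF assms] unfolding normal_forms_def
proof (elim UnE imageE CollectE exE conjE)
  fix t assume "(\<one>, h) = pair_B t"
  then show ?thesis using pair_B_one by (auto simp: pair_B_def)
next
  fix t r assume *: "(\<one>, h) = pair_B t \<otimes>\<^bsub>K\<^esub> r" "t \<in> B" "r \<in> words"
  have r: "fst r \<in> carrier G" using words_closed[OF *(3)] by auto
  have "t \<otimes> fst r = \<one>" using *(1) by (simp add: pair_B_def mult_DirProd')
  then have "inv t \<otimes> (t \<otimes> fst r) = inv t" using *(2) B_carrier by simp
  then have "fst r = inv t" using r *(2) B_carrier by (simp add: m_assoc[symmetric])
  then have "fst r \<in> B" using *(2) B by (simp add: subgroup.m_inv_closed)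
  then show ?thesis using fst_words[OF *(3)] pp_disj by blast
qed

lemma \<Gamma>_total: assumes "x \<in> carrier G" shows "\<exists>h. (x, h) \<in> \<Gamma>"
  using generate_eq[OF assms]
proof induction
  case one
  then show ?case using subgroup.one_closed[OF \<Gamma>_subgroup] by auto
next
  case (incl x)
  then have "(x, f x) \<in> \<Gamma> \<or> (x, g x) \<in> \<Gamma>"
    unfolding \<Gamma>_def by (auto simp: pair_A_def pair_B_def intro: generate.incl)
  then show ?case by blast
next
  case (inv x)
  then have "(x, f x) \<in> \<Gamma> \<or> (x, g x) \<in> \<Gamma>"
    unfolding \<Gamma>_def by (auto simp: pair_A_def pair_B_def intro: generate.incl)
  then obtain h where h: "(x, h) \<in> \<Gamma>" by blast
  have "(x, h) \<in> carrier K" using h subgroup.mem_carrier[OF \<Gamma>_subgroup] by blast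
  moreover have "inv\<^bsub>K\<^esub> (x, h) \<in> \<Gamma>" using h subgroup.m_inv_closed[OF \<Gamma>_subgroup] by blast
  ultimately show ?case using is_group H.is_group by auto
next
  case (eng x y)
  then obtain h h' where "(x, h) \<in> \<Gamma>" "(y, h') \<in> \<Gamma>" by blast
  then have "(x, h) \<otimes>\<^bsub>K\<^esub> (y, h') \<in> \<Gamma>" using subgroup.m_closed[OF \<Gamma>_subgroup] by blast
  then show ?case by auto
qed

text \<open>The quotient of two elements over the same x lies over the identity, where
  \<open>\<Gamma>_one\<close> applies.\<close>

lemma \<Gamma>_unique: assumes "(x, h) \<in> \<Gamma>" "(x, h') \<in> \<Gamma>" shows "h = h'"
proof -
  have c: "x \<in> carrier G" "h \<in> carrier H" "h' \<in> carrier H"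
    using assms subgroup.mem_carrier[OF \<Gamma>_subgroup] by auto
  have "(x, h) \<otimes>\<^bsub>K\<^esub> inv\<^bsub>K\<^esub> (x, h') \<in> \<Gamma>"
    using assms subgroup.m_closed[OF \<Gamma>_subgroup] subgroup.m_inv_closed[OF \<Gamma>_subgroup] by blast
  then have "(\<one>, h \<otimes>\<^bsub>H\<^esub> inv\<^bsub>H\<^esub> h') \<in> \<Gamma>"
    using c is_group H.is_group by simp
  then have "h \<otimes>\<^bsub>H\<^esub> inv\<^bsub>H\<^esub> h' = \<one>\<^bsub>H\<^esub>" by (rule \<Gamma>_one)
  then show ?thesis using c by (metis H.inv_closed H.inv_inv H.inv_equality)
qed

text \<open>Restricting to the carrier selects the extensional representative that
  \<open>amalgamated_sum\<close> asks for.\<close>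

definition "glue = (\<lambda>x \<in> carrier G. THE h. (x, h) \<in> \<Gamma>)"

lemma glue_eq: assumes "(x, h) \<in> \<Gamma>" shows "glue x = h"
proof -
  have "x \<in> carrier G" using assms subgroup.mem_carrier[OF \<Gamma>_subgroup] by auto
  then show ?thesis unfolding glue_def using assms \<Gamma>_unique by auto
qed

lemma glue_\<Gamma>: "x \<in> carrier G \<Longrightarrow> (x, glue x) \<in> \<Gamma>"
  using \<Gamma>_total[of x] by (auto simp: glue_eq)

lemma glue_hom: "glue \<in> hom G H"
proof (rule homI)
  fix x assume "x \<in> carrier G"
  then show "glue x \<in> carrier H"
    using subgroup.mem_carrier[OF \<Gamma>_subgroup glue_\<Gamma>] by simp
next
  fix x y assume "x \<in> carrier G" "y \<in> carrier G"
  then have "(x, glue x) \<otimes>\<^bsub>K\<^esub> (y, glue y) \<in> \<Gamma>"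
    using glue_\<Gamma> subgroup.m_closed[OF \<Gamma>_subgroup] by blast
  then show "glue (x \<otimes> y) = glue x \<otimes>\<^bsub>H\<^esub> glue y" by (simp add: glue_eq)
qed

text \<open>Existence holds because \<open>\<Gamma>\<close> contains both graphs; uniqueness holds
  because A and B generate G.\<close>

lemma universal:
  "\<exists>!k. k \<in> hom G H \<and> k \<in> extensional (carrier G) \<and> (\<forall>x\<in>A. k x = f x) \<and> (\<forall>x\<in>B. k x = g x)"
proof (rule ex1I[of _ glue], intro conjI ballI)
  show "glue x = f x" if "x \<in> A" for x
    using that by (intro glue_eq) (auto simp: \<Gamma>_def pair_A_def intro: generate.incl)
  show "glue x = g x" if "x \<in> B" for x
    using that by (intro glue_eq) (auto simp: \<Gamma>_def pair_B_def intro: generate.incl)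
  then show "k = glue" if k: "k \<in> hom G H \<and> k \<in> extensional (carrier G) \<and>
      (\<forall>x\<in>A. k x = f x) \<and> (\<forall>x\<in>B. k x = g x)" for k
  proof (intro extensionalityI[of k "carrier G" glue])
    fix x assume x: "x \<in> carrier G"
    show "k x = glue x"
    proof (rule hom_eq_on_generate[OF H.is_group _ glue_hom _ _ generate_eq[OF x]])
      show "A \<union> B \<subseteq> carrier G" using A_carrier B_carrier by auto
      show "k s = glue s" if "s \<in> A \<union> B" for s
        using that k \<open>\<And>x. x \<in> A \<Longrightarrow> glue x = f x\<close> \<open>\<And>x. x \<in> B \<Longrightarrow> glue x = g x\<close> by auto
    qed (use k in blast)
  qed (use k in \<open>auto simp: glue_def\<close>)
qed (auto simp: glue_hom, simp add: glue_def)

end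

lemma (in amalgam_data) amalgamated_sum: "amalgamated_sum G A B TYPE('h)"
  unfolding amalgamated_sum_def
proof (intro conjI allI impI)
  fix H :: "'h monoid" and f g
  assume *: "group H \<and> f \<in> hom (G\<lparr>carrier := A\<rparr>) H \<and> g \<in> hom (G\<lparr>carrier := B\<rparr>) H \<and>
    (\<forall>x\<in>A \<inter> B. f x = g x)"
  interpret amalgam_cocone G A B \<Omega> w \<mu> H f g
    by (intro amalgam_cocone.intro amalgam_cocone_axioms.intro amalgam_data_axioms) (use * in auto)
  show "\<exists>!k. k \<in> hom G H \<and> k \<in> extensional (carrier G) \<and>
      (\<forall>x\<in>A. k x = f x) \<and> (\<forall>x\<in>B. k x = g x)" by (rule universal)
qed (use A B is_group in auto)

section \<open>Unitary and orthogonal matrices\<close>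

text \<open>This is the adjugate. It gives inverses in \<open>SL3\<close> by polynomial formulas,
  valid over any commutative ring, and visibly preserves constant and upper triangular
  matrices.\<close>

definition adj3 :: "'r::comm_ring_1 ^ 3 ^ 3 \<Rightarrow> 'r ^ 3 ^ 3" where
  "adj3 A = vector
     [vector [A$2$2 * A$3$3 - A$2$3 * A$3$2, A$1$3 * A$3$2 - A$1$2 * A$3$3, A$1$2 * A$2$3 - A$1$3 * A$2$2],
      vector [A$2$3 * A$3$1 - A$2$1 * A$3$3, A$1$1 * A$3$3 - A$1$3 * A$3$1, A$1$3 * A$2$1 - A$1$1 * A$2$3],
      vector [A$2$1 * A$3$2 - A$2$2 * A$3$1, A$1$2 * A$3$1 - A$1$1 * A$3$2, A$1$1 * A$2$2 - A$1$2 * A$2$1]]"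

lemma mat3_eqI:
  assumes "\<And>i. i \<in> {1, 2, 3} \<Longrightarrow> A$i$1 = B$i$1 \<and> A$i$2 = B$i$2 \<and> A$i$3 = B$i$3"
  shows "A = (B :: 'r ^ 3 ^ 3)"
  using assms by (auto simp: vec_eq_iff forall_3)

lemma mult_adj3: "A ** adj3 A = mat (det A)" and adj3_mult: "adj3 A ** A = mat (det A)"
  by (rule mat3_eqI;
      auto simp: adj3_def matrix_matrix_mult_def sum_3 det_3 mat_def algebra_simps)+

lemma adj3_det: "det A = 1 \<Longrightarrow> det (adj3 A) = 1"
  using arg_cong[OF adj3_mult[of A], of det] by (simp add: det_mul)

lemma group_SL3: "group (SL3 :: ('r::comm_ring_1 ^ 3 ^ 3) monoid)"
proof (rule groupI)
  fix A :: "'r ^ 3 ^ 3" assume "A \<in> carrier SL3"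
  then show "\<exists>B\<in>carrier SL3. B \<otimes>\<^bsub>SL3\<^esub> A = \<one>\<^bsub>SL3\<^esub>"
    by (intro bexI[of _ "adj3 A"]) (auto simp: SL3_def adj3_mult adj3_det)
qed (auto simp: SL3_def det_mul matrix_mul_assoc)

lemma inv_SL3: "A \<in> carrier SL3 \<Longrightarrow> inv\<^bsub>SL3\<^esub> A = adj3 A"
  by (rule group.inv_equality[OF group_SL3]) (auto simp: SL3_def adj3_mult adj3_det)

lemma SU_subgroup: "subgroup SU SL3"
proof (rule group.subgroupI[OF group_SL3])
  have "mat 1 \<in> SU" by (simp add: SU_def SL3_def)
  then show "SU \<noteq> {}" by blast
next
  fix A :: "'a poly ^ 3 ^ 3" assume A: "A \<in> SU"
  then have "herm (adj3 A *v v) = herm v" for v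
    using mult_adj3[of A] unfolding SU_def SL3_def
    by (auto dest: spec[of _ "adj3 A *v v"] simp: matrix_vector_mul_assoc)
  then show "inv\<^bsub>SL3\<^esub> A \<in> SU" using A by (auto simp: SU_def inv_SL3) (simp add: SL3_def adj3_det)
qed (auto simp: SU_def SL3_def det_mul simp flip: matrix_vector_mul_assoc)

lemma two_neq_0: assumes "CHAR('a::field) \<noteq> 2" shows "(2 :: 'a) \<noteq> 0"
proof
  assume "(2 :: 'a) = 0"
  then have "CHAR('a) dvd 2" by (simp flip: of_nat_eq_0_iff_char_dvd)
  then show False using assms dvd_imp_le[of "CHAR('a)" 2] CHAR_not_1'
    by (cases "CHAR('a) = 0") (auto simp: le_Suc_eq numeral_2_eq_2)
qed

section \<open>Conjugation, polarisation and Gram matrices\<close>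

lemma bar_0 [simp]: "bar 0 = 0" and bar_1 [simp]: "bar 1 = 1" and bar_const [simp]: "bar [:c:] = [:c:]"
  and bar_minus [simp]: "bar (- p) = - bar p" and bar_diff: "bar (p - q) = bar p - bar q"
  by (simp_all add: bar_def pcompose_uminus pcompose_diff one_pCons flip: pCons_one)

lemma degree_bar [simp]: "degree (bar p) = degree p"
  by (simp add: bar_def degree_pcompose sqrt_t_def)

lemma bar_eq_0_iff [simp]: "bar p = 0 \<longleftrightarrow> p = 0"
  by (metis bar_bar bar_0)

lemmas bar_simps = bar_add bar_mult bar_bar bar_diff

text \<open>The sesquilinear form \<open>hB\<close> and the bilinear form \<open>qB\<close> below
  restrict on the diagonal to \<open>herm\<close> and \<open>qform\<close>.\<close>

definition hB :: "'a::field poly ^ 3 \<Rightarrow> 'a poly ^ 3 \<Rightarrow> 'a poly" where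
  "hB u v = u $ 1 * bar (v $ 3) + u $ 2 * bar (v $ 2) + u $ 3 * bar (v $ 1)"

definition qB :: "'a::field ^ 3 \<Rightarrow> 'a ^ 3 \<Rightarrow> 'a" where
  "qB u v = u $ 1 * v $ 3 + u $ 2 * v $ 2 + u $ 3 * v $ 1"

lemma hB_bar: "bar (hB u v) = hB v u"
  by (simp add: hB_def bar_simps algebra_simps)

text \<open>Polarising \<open>herm\<close> only controls the sum of \<open>hB u v\<close> and its
  conjugate. Replacing u by \<open>sqrt_t *s u\<close> turns this sum into a difference, because
  \<open>sqrt_t\<close> is skew; sum and difference together determine \<open>hB\<close> when 2 is
  invertible.\<close>

lemma hB_preserved:
  assumes ch: "CHAR('a::field) \<noteq> 2" and A: "\<And>v :: 'a poly ^ 3. herm (A *v v) = herm v"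
  shows "hB (A *v u) (A *v v) = hB u v"
proof -
  define D where "D u v = hB (A *v u) (A *v v) - hB u v" for u v
  have D_bar: "bar (D u v) = D v u" for u v by (simp add: D_def bar_diff hB_bar)
  have h: "herm (u + v) = herm u + herm v + hB u v + hB v u" for u v :: "'a poly ^ 3"
    by (simp add: herm_def hB_def bar_simps algebra_simps)
  have sym: "D u v + D v u = 0" for u v
    using A[of "u + v"] by (simp add: D_def h matrix_vector_right_distrib A algebra_simps)
  have sc: "D (sqrt_t *s u) v = sqrt_t * D u v"
    by (simp add: D_def hB_def matrix_vector_mult_def sum_3 algebra_simps)
  have "D u v = D v u"
  proof -
    have "sqrt_t * D u v + bar (sqrt_t * D u v) = 0"
      using sym[of "sqrt_t *s u" v] D_bar[of "sqrt_t *s u" v] by (simp add: sc)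
    then have "sqrt_t * (D u v - D v u) = 0"
      by (simp add: bar_simps D_bar bar_sqrt_t algebra_simps)
    then show ?thesis by (simp add: sqrt_t_def)
  qed
  then have "smult 2 (D u v) = 0"
    using sym[of u v] smult_add_left[of 1 1 "D u v"] by simp
  then show ?thesis using two_neq_0[OF ch] by (simp add: D_def)
qed

text \<open>The Gram matrix of the standard basis. It is polymorphic so that the hermitian and the
  quadratic form share it.\<close>

definition J3 :: "3 \<Rightarrow> 3 \<Rightarrow> 'r::zero_neq_one" where
  "J3 i j = (if i = 1 \<and> j = 3 \<or> i = 2 \<and> j = 2 \<or> i = 3 \<and> j = 1 then 1 else 0)"

lemma J3_simps [simp]:
  "J3 1 1 = 0" "J3 1 2 = 0" "J3 1 3 = 1" "J3 2 1 = 0" "J3 2 2 = 1" "J3 2 3 = 0"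
  "J3 3 1 = 1" "J3 3 2 = 0" "J3 3 3 = 0"
  by (simp_all add: J3_def)

lemma mult_axis_1: "A *v axis j 1 = column j (A :: 'r::comm_ring_1 ^ 3 ^ 3)"
  by (simp add: vec_eq_iff matrix_vector_mult_def column_def axis_def if_distrib cong: if_cong)

text \<open>The columns are the images of the basis vectors, so \<open>hB_preserved\<close> gives
  one direction; expanding \<open>herm (A *v v)\<close> sesquilinearly in the columns gives the
  other.\<close>

lemma SU_iff:
  assumes ch: "CHAR('a::field) \<noteq> 2"
  shows "A \<in> SU \<longleftrightarrow> det A = 1 \<and> (\<forall>i j. hB (column i A) (column j (A :: 'a poly ^ 3 ^ 3)) = J3 i j)"
proof safe
  assume A: "A \<in> SU"
  then show "det A = 1" by (simp add: SU_def SL3_def)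
  have *: "\<forall>i j. hB (axis i 1 :: 'a poly ^ 3) (axis j 1) = J3 i j"
    unfolding forall_3 by (simp add: hB_def axis_def)
  show "hB (column i A) (column j A) = J3 i j" for i j
    using hB_preserved[OF ch, of A "axis i 1" "axis j 1"] A *
    by (simp add: mult_axis_1 SU_def)
next
  assume d: "det A = 1" and B: "\<forall>i j. hB (column i A) (column j A) = J3 i j"
  have "herm (A *v v) = (\<Sum>i\<in>UNIV. \<Sum>j\<in>UNIV. v$i * bar (v$j) * hB (column i A) (column j A))" for v
    by (simp add: herm_def hB_def matrix_vector_mult_def sum_3 column_def bar_simps algebra_simps)
  then have "herm (A *v v) = herm v" for v
    by (simp add: B sum_3 herm_def)
  then show "A \<in> SU" using d by (simp add: SU_def SL3_def)
qed

lemma SO3_iff: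
  assumes ch: "CHAR('a::field) \<noteq> 2"
  shows "A \<in> SO3 \<longleftrightarrow> det A = 1 \<and> (\<forall>i j. qB (column i A) (column j (A :: 'a ^ 3 ^ 3)) = J3 i j)"
proof safe
  assume A: "A \<in> SO3"
  then show "det A = 1" by (simp add: SO3_def SL3_def)
  have *: "\<forall>i j. qB (axis i 1 :: 'a ^ 3) (axis j 1) = J3 i j"
    unfolding forall_3 by (simp add: qB_def axis_def)
  have h: "qform (u + v) = qform u + qform v + 2 * qB u v" for u v :: "'a ^ 3"
    by (simp add: qform_def qB_def power2_eq_square algebra_simps)
  have pres: "qform (A *v v) = qform v" for v using A by (simp add: SO3_def)
  have "2 * qB (A *v u) (A *v v) = 2 * qB u v" for u v
    using pres[of "u + v"] by (simp add: h matrix_vector_right_distrib pres)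
  then have "qB (A *v u) (A *v v) = qB u v" for u v using two_neq_0[OF ch] by simp
  from this[of "axis i 1" "axis j 1" for i j]
  show "qB (column i A) (column j A) = J3 i j" for i j
    using * by (simp add: mult_axis_1)
next
  assume d: "det A = 1" and B: "\<forall>i j. qB (column i A) (column j A) = J3 i j"
  have "qform (A *v v) = (\<Sum>i\<in>UNIV. \<Sum>j\<in>UNIV. v$i * v$j * qB (column i A) (column j A))" for v
    by (simp add: qform_def qB_def matrix_vector_mult_def sum_3 column_def power2_eq_square algebra_simps)
  then have "qform (A *v v) = qform v" for v
    by (simp add: B sum_3 qform_def power2_eq_square algebra_simps)
  then show "A \<in> SO3" using d by (simp add: SO3_def SL3_def)
qed

section \<open>Constant matrices and the orthogonal group\<close>

lemma det_const_mat: "det (const_mat A) = [:det A:]"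
  by (simp add: const_mat_def det_3 algebra_simps)

text \<open>\<open>SU\<close> tests polynomial vectors and \<open>SO3\<close> only constant ones,
  but both conditions reduce to the Gram matrix of the columns, and conjugation is trivial on
  constants.\<close>

lemma const_mat_SU_iff:
  assumes ch: "CHAR('a::field) \<noteq> 2"
  shows "const_mat A \<in> SU \<longleftrightarrow> (A :: 'a ^ 3 ^ 3) \<in> SO3"
proof -
  have "hB (column i (const_mat A)) (column j (const_mat A)) = [:qB (column i A) (column j A):]" for i j
    by (simp add: hB_def qB_def const_mat_def column_def)
  moreover have one: "[:c:] = 1 \<longleftrightarrow> c = 1" for c :: 'a by (simp add: one_pCons)
  moreover have "[:c:] = J3 i j \<longleftrightarrow> c = J3 i j" for c :: 'a and i j by (simp add: J3_def one)
  ultimately show ?thesis by (simp only: SU_iff[OF ch] SO3_iff[OF ch] det_const_mat)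
qed

lemma const_mat_inj: "const_mat A = const_mat B \<longleftrightarrow> A = B"
  by (auto simp: const_mat_def vec_eq_iff)

lemma const_mat_mult: "const_mat (A ** B) = const_mat A ** const_mat B"
  by (rule mat3_eqI) (auto simp: const_mat_def matrix_matrix_mult_def sum_3)

lemma Fgrp_eq_image:
  assumes ch: "CHAR('a::field) \<noteq> 2"
  shows "(Fgrp :: ('a poly ^ 3 ^ 3) set) = const_mat ` SO3"
proof
  show "(Fgrp :: ('a poly ^ 3 ^ 3) set) \<subseteq> const_mat ` SO3"
    by (auto simp: Fgrp_def GL3_const_def const_mat_SU_iff[OF ch])
  show "const_mat ` SO3 \<subseteq> (Fgrp :: ('a poly ^ 3 ^ 3) set)"
    by (auto simp: Fgrp_def GL3_const_def const_mat_SU_iff[OF ch] invertible_det_nz SO3_iff[OF ch])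
qed

lemma const_mat_iso:
  assumes ch: "CHAR('a::field) \<noteq> 2"
  shows "const_mat \<in> iso (SL3\<lparr>carrier := (SO3 :: ('a ^ 3 ^ 3) set)\<rparr>) (SL3\<lparr>carrier := Fgrp\<rparr>)"
  by (auto simp: iso_def hom_def bij_betw_def inj_on_def Fgrp_eq_image[OF ch] const_mat_inj
      const_mat_mult SL3_def)

lemma Fgrp_iff:
  assumes ch: "CHAR('a::field) \<noteq> 2"
  shows "A \<in> Fgrp \<longleftrightarrow> A \<in> SU \<and> (\<forall>i j. degree ((A :: 'a poly ^ 3 ^ 3) $ i $ j) = 0)"
proof safe
  assume A: "A \<in> SU" "\<forall>i j. degree (A $ i $ j) = 0"
  have "A = const_mat (map_matrix (\<lambda>p. coeff p 0) A)"
    using A(2) by (simp add: const_mat_def vec_eq_iff degree_eq_zeroE) (metis coeff_pCons_0 degree_eq_zeroE)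
  then show "A \<in> Fgrp"
    using A(1) const_mat_SU_iff[OF ch] unfolding Fgrp_eq_image[OF ch] by (metis image_eqI)
qed (auto simp: Fgrp_def GL3_const_def const_mat_def)

lemma const_mat_adj3: "const_mat (adj3 A) = adj3 (const_mat A)"
  by (rule mat3_eqI) (auto simp: const_mat_def adj3_def)

lemma Fgrp_iff_range:
  assumes ch: "CHAR('a::field) \<noteq> 2"
  shows "(A :: 'a poly ^ 3 ^ 3) \<in> Fgrp \<longleftrightarrow> A \<in> SU \<and> A \<in> range const_mat"
  using const_mat_SU_iff[OF ch] unfolding Fgrp_eq_image[OF ch] by auto

lemma Fgrp_subgroup:
  assumes ch: "CHAR('a::field) \<noteq> 2"
  shows "subgroup (Fgrp :: ('a poly ^ 3 ^ 3) set) SL3"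
proof (rule group.subgroupI[OF group_SL3])
  show "Fgrp \<subseteq> (carrier SL3 :: ('a poly ^ 3 ^ 3) set)"
    using subgroup.subset[OF SU_subgroup] by (auto simp: Fgrp_def)
  have "mat 1 = const_mat (mat 1 :: 'a ^ 3 ^ 3)"
    by (rule mat3_eqI) (auto simp: const_mat_def mat_def one_pCons)
  moreover have "(mat 1 :: 'a poly ^ 3 ^ 3) \<in> SU" by (simp add: SU_def SL3_def)
  ultimately show "(Fgrp :: ('a poly ^ 3 ^ 3) set) \<noteq> {}" using Fgrp_iff_range[OF ch] by blast
next
  fix A :: "'a poly ^ 3 ^ 3" assume A: "A \<in> Fgrp"
  then have "inv\<^bsub>SL3\<^esub> A \<in> SU" "inv\<^bsub>SL3\<^esub> A = adj3 A"
    using subgroup.m_inv_closed[OF SU_subgroup] inv_SL3 by (auto simp: Fgrp_def SU_def)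
  then show "inv\<^bsub>SL3\<^esub> A \<in> Fgrp"
    using A by (auto simp: Fgrp_iff_range[OF ch] simp flip: const_mat_adj3)
next
  fix A B :: "'a poly ^ 3 ^ 3" assume AB: "A \<in> Fgrp" "B \<in> Fgrp"
  then have "A \<otimes>\<^bsub>SL3\<^esub> B \<in> SU"
    using subgroup.m_closed[OF SU_subgroup] by (auto simp: Fgrp_def)
  then show "A \<otimes>\<^bsub>SL3\<^esub> B \<in> Fgrp"
    using AB by (auto simp: Fgrp_iff_range[OF ch] SL3_def simp flip: const_mat_mult)
qed

section \<open>Upper triangular matrices\<close>

lemma Tgrp_subgroup: "subgroup (Tgrp :: ('a::field poly ^ 3 ^ 3) set) SL3"
proof (rule group.subgroupI[OF group_SL3])
  show "Tgrp \<subseteq> (carrier SL3 :: ('a poly ^ 3 ^ 3) set)"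
    by (auto simp: Tgrp_def SU_def)
  have "(mat 1 :: 'a poly ^ 3 ^ 3) \<in> Tgrp"
    by (simp add: Tgrp_def SU_def SL3_def upper_triangular3_def) (simp add: mat_def)
  then show "(Tgrp :: ('a poly ^ 3 ^ 3) set) \<noteq> {}" by blast
next
  fix A :: "'a poly ^ 3 ^ 3" assume A: "A \<in> Tgrp"
  then have "inv\<^bsub>SL3\<^esub> A \<in> SU" "inv\<^bsub>SL3\<^esub> A = adj3 A"
    using subgroup.m_inv_closed[OF SU_subgroup] inv_SL3 by (auto simp: Tgrp_def SU_def)
  then show "inv\<^bsub>SL3\<^esub> A \<in> Tgrp"
    using A by (auto simp: Tgrp_def upper_triangular3_def adj3_def)
next
  fix A B :: "'a poly ^ 3 ^ 3" assume AB: "A \<in> Tgrp" "B \<in> Tgrp"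
  then have "A \<otimes>\<^bsub>SL3\<^esub> B \<in> SU"
    using subgroup.m_closed[OF SU_subgroup] by (auto simp: Tgrp_def)
  then show "A \<otimes>\<^bsub>SL3\<^esub> B \<in> Tgrp"
    using AB by (auto simp: Tgrp_def SL3_def upper_triangular3_def matrix_matrix_mult_def sum_3)
qed

lemma bar_smult [simp]: "bar (smult c p) = smult c (bar p)"
  by (simp add: bar_def pcompose_smult)

text \<open>If the last entry of the first column vanishes, isotropy forces the middle one to
  vanish. Pairing with the third column shows that the first entry is nonzero, and orthogonality to
  the second column then kills the entry (3,2).\<close>

lemma Tgrp_iff:
  assumes ch: "CHAR('a::field) \<noteq> 2" and A: "(A :: 'a poly ^ 3 ^ 3) \<in> SU"
  shows "A \<in> Tgrp \<longleftrightarrow> A $ 3 $ 1 = 0"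
proof
  assume 31: "A $ 3 $ 1 = 0"
  have h: "hB (column i A) (column j A) = J3 i j" for i j using A SU_iff[OF ch] by blast
  have 21: "A $ 2 $ 1 = 0" using h[of 1 1] 31 by (simp add: hB_def column_def)
  have "A $ 1 $ 1 \<noteq> 0" using h[of 1 3] 31 21 by (auto simp: hB_def column_def)
  then have "A $ 3 $ 2 = 0" using h[of 1 2] 31 21 by (simp add: hB_def column_def)
  then show "A \<in> Tgrp" using A 31 21 by (simp add: Tgrp_def upper_triangular3_def)
qed (simp add: Tgrp_def upper_triangular3_def)

lemma tri_mat_nth [simp]:
  "tri_mat c x y $ 1 $ 1 = [:c:]" "tri_mat c x y $ 1 $ 2 = - bar x"
  "tri_mat c x y $ 1 $ 3 = [:inverse c:] * y" "tri_mat c x y $ 2 $ 1 = 0"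
  "tri_mat c x y $ 2 $ 2 = 1" "tri_mat c x y $ 2 $ 3 = [:inverse c:] * x"
  "tri_mat c x y $ 3 $ 1 = 0" "tri_mat c x y $ 3 $ 2 = 0" "tri_mat c x y $ 3 $ 3 = [:inverse c:]"
  by (simp_all add: tri_mat_def)

lemma tri_mat_Tgrp:
  assumes ch: "CHAR('a::field) \<noteq> 2" and c: "c \<noteq> 0" and xy: "Nm x + Tr y = (0 :: 'a poly)"
  shows "tri_mat c x y \<in> Tgrp"
proof -
  \<comment> \<open>The pairing of the third column with itself is the relation on x and y, scaled
    by the inverse square of c.\<close>
  have "smult (inverse c) y * [:inverse c:] + smult (inverse c) x * smult (inverse c) (bar x)
      + [:inverse c:] * smult (inverse c) (bar y) = smult (inverse c * inverse c) (Nm x + Tr y)"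
    by (simp add: Nm_def Tr_def algebra_simps smult_add_right)
  then have *: "smult (inverse c * inverse c) y + smult (inverse c * inverse c) (x * bar x)
      + smult (inverse c * inverse c) (bar y) = 0"
    using xy by simp
  then have "\<forall>i j. hB (column i (tri_mat c x y)) (column j (tri_mat c x y)) = J3 i j"
    using c xy unfolding forall_3 by (simp add: hB_def column_def bar_simps one_pCons)
  moreover have "det (tri_mat c x y) = 1" using c by (simp add: det_3 one_pCons)
  ultimately have "tri_mat c x y \<in> SU" using SU_iff[OF ch] by blast
  then show ?thesis by (simp add: Tgrp_def upper_triangular3_def)
qed

text \<open>Determinant 1 makes the corner entry a unit, hence a constant c. The pairings of columns
  1 and 3, of 2 and 3, and of 3 with itself then fix the entry (3,3), the entry (1,2), and the
  relation between x and y.\<close>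

lemma Tgrp_eq:
  assumes ch: "CHAR('a::field) \<noteq> 2"
  shows "(Tgrp :: ('a poly ^ 3 ^ 3) set) = {tri_mat c x y | c x y. c \<noteq> 0 \<and> Nm x + Tr y = 0}"
proof (intro equalityI subsetI)
  fix A :: "'a poly ^ 3 ^ 3" assume A: "A \<in> Tgrp"
  then have z: "A $ 2 $ 1 = 0" "A $ 3 $ 1 = 0" "A $ 3 $ 2 = 0" and SU: "A \<in> SU"
    by (auto simp: Tgrp_def upper_triangular3_def)
  have h: "hB (column i A) (column j A) = J3 i j" and d: "det A = 1" for i j
    using SU SU_iff[OF ch] by blast+
  have d: "A $ 1 $ 1 * A $ 2 $ 2 * A $ 3 $ 3 = 1" using d z by (simp add: det_3)
  have "A $ 1 $ 1 dvd 1" using d by (intro dvdI[of _ _ "A $ 2 $ 2 * A $ 3 $ 3"]) (simp add: mult.assoc)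
  then obtain c where c: "A $ 1 $ 1 = [:c:]" "c \<noteq> 0"
    by (auto simp: is_unit_poly_iff dvd_field_iff)
  have "[:c:] * bar (A $ 3 $ 3) = 1" using h[of 1 3] z c by (simp add: hB_def column_def)
  then have "[:inverse c:] * ([:c:] * bar (A $ 3 $ 3)) = [:inverse c:]" by simp
  then have "bar (A $ 3 $ 3) = [:inverse c:]" using c by simp
  then have c3: "A $ 3 $ 3 = [:inverse c:]" by (metis bar_bar bar_const)
  have c2: "A $ 2 $ 2 = 1" using d c c3 by simp
  define x where "x = [:c:] * A $ 2 $ 3"
  define y where "y = [:c:] * A $ 1 $ 3"
  have e: "A $ 2 $ 3 = [:inverse c:] * x" "A $ 1 $ 3 = [:inverse c:] * y"
    using c by (simp_all add: x_def y_def)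
  have "smult c (A $ 1 $ 2 * [:inverse c:] + smult (inverse c) (bar x)) = 0"
    using h[of 2 3] z c c2 c3 e by (simp add: hB_def column_def bar_simps)
  then have f: "A $ 1 $ 2 = - bar x" using c by (simp add: smult_add_right eq_neg_iff_add_eq_0)
  have "smult (inverse c * inverse c) (Nm x + Tr y) = hB (column 3 A) (column 3 A)"
    by (simp add: Nm_def Tr_def algebra_simps smult_add_right hB_def column_def bar_simps e c3)
  then have "Nm x + Tr y = 0" using h[of 3 3] c by simp
  moreover have "A = tri_mat c x y"
    by (rule mat3_eqI) (auto simp: z c c2 c3 e f)
  ultimately show "A \<in> {tri_mat c x y | c x y. c \<noteq> 0 \<and> Nm x + Tr y = 0}" using c by blast
qed (use tri_mat_Tgrp[OF ch] in blast)

text \<open>The nontrivial Weyl group element; the middle entry -1 makes its determinant 1. Left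
  multiplication by it exchanges the outer entries of the first column.\<close>

definition weyl :: "'a::field poly ^ 3 ^ 3" where
  "weyl = vector [vector [0, 0, 1], vector [0, - 1, 0], vector [1, 0, 0]]"

lemma weyl_mult_nth [simp]:
  "(weyl ** A) $ 1 $ j = A $ 3 $ j" "(weyl ** A) $ 2 $ j = - (A $ 2 $ j)"
  "(weyl ** A) $ 3 $ j = A $ 1 $ j"
  by (simp_all add: weyl_def matrix_matrix_mult_def sum_3)

lemma weyl_weyl: "weyl ** weyl = mat 1"
  by (rule mat3_eqI) (auto simp: mat_def, auto simp: weyl_def)

lemma weyl_Fgrp:
  assumes ch: "CHAR('a::field) \<noteq> 2"
  shows "(weyl :: 'a poly ^ 3 ^ 3) \<in> Fgrp"
proof -
  have "\<forall>i j. hB (column i weyl) (column j (weyl :: 'a poly ^ 3 ^ 3)) = J3 i j"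
    unfolding forall_3 by (simp add: hB_def column_def weyl_def)
  moreover have "det (weyl :: 'a poly ^ 3 ^ 3) = 1" by (simp add: det_3 weyl_def)
  ultimately show ?thesis
    unfolding Fgrp_iff[OF ch] SU_iff[OF ch] by (simp add: forall_3 weyl_def)
qed

lemma tri_mat_Fgrp:
  assumes ch: "CHAR('a::field) \<noteq> 2" and c: "c \<noteq> 0" and xy: "Nm x + Tr y = (0 :: 'a poly)"
    and "degree x = 0" "degree y = 0"
  shows "tri_mat c x y \<in> Fgrp"
  using tri_mat_Tgrp[OF ch c xy] assms(4,5) by (simp add: Fgrp_iff[OF ch] forall_3 Tgrp_def)

section \<open>Degrees of the first column\<close>

lemma degree_poly_div_le: "degree (a div b) \<le> degree (a :: 'a::field poly)"
proof (cases "a div b = 0 \<or> b = 0")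
  case False
  then have nz: "a div b * b \<noteq> 0" and d: "degree (a div b * b) = degree (a div b) + degree b"
    by (auto simp: degree_mult_eq)
  have "degree (a mod b) < degree (a div b * b) \<or> a mod b = 0"
    using degree_mod_less[of b a] False d by auto
  then have "degree a = degree (a div b * b)"
    using degree_add_eq_left[of "a mod b" "a div b * b"] div_mult_mod_eq[of a b] by auto
  then show ?thesis using d by simp
qed auto

lemma degree_Nm: "degree (Nm x) = 2 * degree x"
  by (cases "x = 0") (simp_all add: Nm_def degree_mult_eq)

text \<open>Conjugation preserves degrees, so N doubles the degree while T cannot raise it.\<close>

lemma Nm_Tr_degree:
  assumes "Nm x + Tr y = 0" shows "2 * degree x \<le> degree (y :: 'a::field poly)"
proof -
  have "degree (Nm x) = degree (Tr y)" using assms by (metis add_eq_0_iff degree_minus)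
  also have "\<dots> \<le> degree y" unfolding Tr_def by (rule degree_add_le) simp_all
  finally show ?thesis by (simp add: degree_Nm)
qed

text \<open>Since \<open>Tr (u div v)\<close> is the coefficient of \<open>Nm v\<close> in the isotropy relation, it vanishes for
  degree reasons.\<close>

lemma quotient_skew:
  assumes iso: "u * bar v + r * bar r + v * bar u = (0 :: 'a::field poly)"
    and v: "v \<noteq> 0" and r: "r = 0 \<or> degree r < degree v"
  shows "Tr (u div v) = 0"
proof (rule ccontr)
  assume nz: "Tr (u div v) \<noteq> 0"
  define s where "s = u mod v"
  have s: "s = 0 \<or> degree s < degree v" unfolding s_def using v by (rule degree_mod_less)
  have u: "u = u div v * v + s" by (simp add: s_def)
  have "Tr (u div v) * (v * bar v) = - (s * bar v + r * bar r + v * bar s)"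
    using iso by (subst (asm) (1 2) u) (simp add: Tr_def bar_simps algebra_simps eq_neg_iff_add_eq_0)
  then have eq: "degree (Tr (u div v)) + 2 * degree v = degree (s * bar v + r * bar r + v * bar s)"
    using nz v by (metis degree_minus degree_mult_eq degree_Nm Nm_def mult_eq_0_iff bar_eq_0_iff)
  show False
  proof (cases "degree v = 0")
    \<comment> \<open>For constant v a degree strictly below twice that of v is impossible, but then
      both remainders are zero.\<close>
    case True
    then have "s = 0" "r = 0" using r s by auto
    then have "Tr (u div v) * (v * bar v) = 0"
      using \<open>Tr (u div v) * (v * bar v) = - (s * bar v + r * bar r + v * bar s)\<close> by simp
    then show False using nz v by simp
  next
    case False
    then have "degree s < degree v" "degree r < degree v" using r s by auto
    then have "degree (s * bar v) < 2 * degree v" "degree (r * bar r) < 2 * degree v"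
      "degree (v * bar s) < 2 * degree v"
      by (auto intro: le_less_trans[OF degree_mult_le])
    then have "degree (s * bar v + r * bar r + v * bar s) < 2 * degree v"
      by (intro degree_add_less)
    then show False using eq by simp
  qed
qed

text \<open>Two divisions by the last entry v: x reduces the second entry modulo v, which alters the
  first one; then the quotient q of the new first entry is skew by \<open>quotient_skew\<close>, so
  that subtracting q times v is a move within \<open>Tgrp\<close>.\<close>

lemma descent_step:
  assumes ch: "CHAR('a::field) \<noteq> 2" and A: "(A :: 'a poly ^ 3 ^ 3) \<in> SU" and 31: "A $ 3 $ 1 \<noteq> 0"
  obtains t where "t \<in> Tgrp" "(t ** A) $ 1 $ 1 = 0 \<or> degree ((t ** A) $ 1 $ 1) < degree (A $ 3 $ 1)"
    "A \<in> Fgrp \<Longrightarrow> t \<in> Fgrp"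
proof -
  define v where "v = A $ 3 $ 1"
  define x where "x = - (A $ 2 $ 1 div v)"
  \<comment> \<open>The norm of x is fixed by conjugation, so minus half of it has trace minus the
    norm; this uses that 2 is invertible.\<close>
  define y where "y = - smult (inverse 2) (Nm x)"
  define B where "B = tri_mat 1 x y ** A"
  define q where "q = B $ 1 $ 1 div v"
  have half: "inverse 2 + inverse 2 = (1 :: 'a)" using two_neq_0[OF ch] by (simp add: field_simps)
  have "Tr y = - (smult (inverse 2) (Nm x) + smult (inverse 2) (Nm x))"
    by (simp add: Tr_def y_def Nm_def bar_simps mult.commute)
  also have "\<dots> = - Nm x" by (simp only: smult_add_left[symmetric] half smult_1_left)
  finally have xy: "Nm x + Tr y = 0" by simp
  note t0 = tri_mat_Tgrp[OF ch one_neq_zero xy]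
  have B: "B \<in> SU"
    using subgroup.m_closed[OF SU_subgroup, of "tri_mat 1 x y" A] t0 A
    by (simp add: B_def Tgrp_def SL3_def)
  have B3: "B $ 3 $ 1 = v" and B2: "B $ 2 $ 1 = A $ 2 $ 1 mod v"
    by (simp_all add: B_def matrix_matrix_mult_def sum_3 v_def x_def minus_mult_div_eq_mod[symmetric])
  have "hB (column 1 B) (column 1 B) = 0" using B SU_iff[OF ch] by (metis J3_simps(1))
  then have "Tr q = 0" unfolding q_def
    using 31 degree_mod_less[of v "A $ 2 $ 1"]
    by (intro quotient_skew[of _ _ "B $ 2 $ 1"]) (auto simp: hB_def column_def B3 B2 v_def)
  then have q: "Nm 0 + Tr (- q) = 0" by (simp add: Nm_def Tr_def neg_eq_iff_add_eq_0)
  note t1 = tri_mat_Tgrp[OF ch one_neq_zero q]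
  define t where "t = tri_mat 1 0 (- q) ** tri_mat 1 x y"
  have tA: "t ** A = tri_mat 1 0 (- q) ** B" by (simp add: t_def B_def matrix_mul_assoc)
  have "(t ** A) $ 1 $ 1 = B $ 1 $ 1 mod v"
    unfolding tA by (simp add: matrix_matrix_mult_def sum_3 B3 q_def minus_div_mult_eq_mod[symmetric])
  then have "(t ** A) $ 1 $ 1 = 0 \<or> degree ((t ** A) $ 1 $ 1) < degree (A $ 3 $ 1)"
    using degree_mod_less[of v "B $ 1 $ 1"] 31 by (simp add: v_def)
  moreover have "t \<in> Tgrp"
    using subgroup.m_closed[OF Tgrp_subgroup t1 t0] by (simp add: t_def SL3_def)
  \<comment> \<open>Division of constants has constant quotients, so x, y and q are all constant
    here.\<close>
  moreover have "t \<in> Fgrp" if AF: "A \<in> Fgrp"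
  proof -
    have dx: "degree x = 0"
      using AF Fgrp_iff[OF ch] degree_poly_div_le[of "A $ 2 $ 1" v] by (simp add: x_def)
    moreover have "degree y = 0" by (simp add: y_def degree_Nm dx)
    ultimately have t0: "tri_mat 1 x y \<in> Fgrp" by (intro tri_mat_Fgrp[OF ch _ xy]) simp_all
    then have "B \<in> Fgrp"
      using subgroup.m_closed[OF Fgrp_subgroup[OF ch] t0 AF] by (simp add: B_def SL3_def)
    then have "degree q = 0"
      using Fgrp_iff[OF ch] degree_poly_div_le[of "B $ 1 $ 1" v] by (simp add: q_def)
    then have "tri_mat 1 0 (- q) \<in> Fgrp" by (intro tri_mat_Fgrp[OF ch _ q]) simp_all
    then show ?thesis
      using subgroup.m_closed[OF Fgrp_subgroup[OF ch] _ t0] by (simp add: t_def SL3_def)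
  qed
  ultimately show ?thesis using that by blast
qed

text \<open>The ping-pong set. A nonzero last entry keeps it away from \<open>Tgrp\<close>; its
  maximal degree makes its product with y dominate in the next step.\<close>

definition dominated :: "('a::field poly ^ 3 ^ 3) set" where
  "dominated = {A. A $ 3 $ 1 \<noteq> 0 \<and> degree (A $ 1 $ 1) \<le> degree (A $ 3 $ 1)
     \<and> degree (A $ 2 $ 1) \<le> degree (A $ 3 $ 1)}"

lemma weyl_Tgrp_dominated:
  assumes ch: "CHAR('a::field) \<noteq> 2" and t: "(t :: 'a poly ^ 3 ^ 3) \<in> Tgrp"
  shows "weyl ** t \<in> dominated"
  using t by (auto simp: Tgrp_eq[OF ch] dominated_def)

text \<open>The term y times the last entry has strictly larger degree than everything else in the
  new first entry, and \<open>weyl\<close> moves that entry to the last place.\<close>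

lemma weyl_Tgrp_dominated_step:
  assumes ch: "CHAR('a::field) \<noteq> 2" and t: "(t :: 'a poly ^ 3 ^ 3) \<in> Tgrp" "t \<notin> Fgrp"
    and A: "A \<in> dominated"
  shows "weyl ** (t ** A) \<in> dominated"
proof -
  obtain c x y where cxy: "t = tri_mat c x y" "c \<noteq> 0" "Nm x + Tr y = 0"
    using t(1) Tgrp_eq[OF ch] by blast
  \<comment> \<open>A constant y would force x to be constant by \<open>Nm_Tr_degree\<close>, and t
    would lie in \<open>Fgrp\<close>.\<close>
  have dy: "degree y \<noteq> 0"
    using tri_mat_Fgrp[OF ch cxy(2,3)] t(2) Nm_Tr_degree[OF cxy(3)] cxy(1) by auto
  then have dx: "degree x < degree y" using Nm_Tr_degree[OF cxy(3)] by simp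
  define p q r where "p = A $ 1 $ 1" and "q = A $ 2 $ 1" and "r = A $ 3 $ 1"
  have r: "r \<noteq> 0" "degree p \<le> degree r" "degree q \<le> degree r"
    using A by (auto simp: dominated_def p_def q_def r_def)
  have tA: "(t ** A) $ 1 $ 1 = smult c p - bar x * q + smult (inverse c) (y * r)"
    "(t ** A) $ 2 $ 1 = q + smult (inverse c) (x * r)" "(t ** A) $ 3 $ 1 = smult (inverse c) r"
    by (simp_all add: cxy(1) matrix_matrix_mult_def sum_3 p_def q_def r_def)
  have yr: "degree (smult (inverse c) (y * r)) = degree y + degree r"
    using cxy(2) r dy by (cases "y = 0") (simp_all add: degree_mult_eq)
  have "degree (bar x * q) \<le> degree x + degree r"
    using degree_mult_le[of "bar x" q] r(3) by simp
  then have "degree (smult c p - bar x * q) < degree y + degree r"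
    using r(2) dx dy cxy(2) by (intro degree_diff_less) auto
  then have d1: "degree ((t ** A) $ 1 $ 1) = degree y + degree r"
    using yr by (simp only: tA degree_add_eq_right)
  moreover have "degree ((t ** A) $ 2 $ 1) \<le> degree y + degree r"
    unfolding tA using degree_mult_le[of x r] r(3) dx cxy(2) by (intro degree_add_le) auto
  moreover have "(t ** A) $ 1 $ 1 \<noteq> 0" using d1 dy by (metis add_is_0 degree_0)
  ultimately show ?thesis using cxy(2) by (simp add: dominated_def tA(3))
qed

lemma SU_amalgamated_sum:
  assumes ch: "CHAR('a::field) \<noteq> 2"
  shows "amalgamated_sum (SL3\<lparr>carrier := (SU :: ('a poly ^ 3 ^ 3) set)\<rparr>) Fgrp Tgrp TYPE('h)"
proof -
  define G where "G = SL3\<lparr>carrier := (SU :: ('a poly ^ 3 ^ 3) set)\<rparr>"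
  have G [simp]: "carrier G = SU" "x \<otimes>\<^bsub>G\<^esub> y = x ** y" "\<one>\<^bsub>G\<^esub> = mat 1" for x y
    by (simp_all add: G_def SL3_def)
  have FG: "subgroup Fgrp G"
    unfolding G_def
    by (rule group.subgroup_incl[OF group_SL3 Fgrp_subgroup[OF ch] SU_subgroup]) (auto simp: Fgrp_def)
  have TG: "subgroup Tgrp G"
    unfolding G_def
    by (rule group.subgroup_incl[OF group_SL3 Tgrp_subgroup SU_subgroup]) (auto simp: Tgrp_def)
  interpret G: group G
    unfolding G_def by (rule group.subgroup_imp_group[OF group_SL3 SU_subgroup])
  have wF: "(weyl :: 'a poly ^ 3 ^ 3) \<in> Fgrp" by (rule weyl_Fgrp[OF ch])
  interpret amalgam_data G Fgrp Tgrp dominated weyl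
    \<comment> \<open>The shift by one separates a zero entry from a nonzero constant, both of
      degree 0, so that the last descent into \<open>Tgrp\<close> is strict as well.\<close>
    "\<lambda>A. if A $ 3 $ 1 = 0 then 0 else Suc (degree (A $ 3 $ 1))"
  proof (rule amalgam_data.intro[OF G.is_group], rule amalgam_data_axioms.intro)
    fix A :: "'a poly ^ 3 ^ 3" assume A: "A \<in> Fgrp" "A \<notin> Tgrp"
    then have SU: "A \<in> SU" by (simp add: Fgrp_def)
    then have "A $ 3 $ 1 \<noteq> 0" using A(2) Tgrp_iff[OF ch] by blast
    then obtain t where t: "t \<in> Tgrp" "t \<in> Fgrp"
      "(t ** A) $ 1 $ 1 = 0 \<or> degree ((t ** A) $ 1 $ 1) < degree (A $ 3 $ 1)"
      using descent_step[OF ch SU] A(1) by metis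
    \<comment> \<open>The divisor is a nonzero constant, so no remainder of smaller degree exists.
      One descent step therefore ends in \<open>Tgrp\<close>, and undoing it with
      \<open>weyl\<close> its own inverse gives the Bruhat decomposition.\<close>
    then have 0: "(t ** A) $ 1 $ 1 = 0" using A(1) Fgrp_iff[OF ch] by simp
    define b where "b = weyl ** (t ** A)"
    have bF: "b \<in> Fgrp"
      unfolding b_def using subgroup.m_closed[OF FG] wF t(2) A(1) by simp
    then have bT: "b \<in> Tgrp" using Tgrp_iff[OF ch] 0 by (simp add: Fgrp_def b_def)
    have "weyl ** b = t ** A" by (simp add: b_def matrix_mul_assoc weyl_weyl)
    moreover have "inv\<^bsub>G\<^esub> t ** (t ** A) = A"
      using t(1) SU G.m_assoc[of "inv\<^bsub>G\<^esub> t" t A] G.l_inv[of t] G.inv_closed[of t] by (simp add: Tgrp_def)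
    moreover have "inv\<^bsub>G\<^esub> t \<in> Fgrp \<inter> Tgrp"
      using t subgroup.m_inv_closed[OF FG] subgroup.m_inv_closed[OF TG] by blast
    ultimately show "\<exists>u\<in>Fgrp \<inter> Tgrp. \<exists>v\<in>Fgrp \<inter> Tgrp. A = u \<otimes>\<^bsub>G\<^esub> (weyl \<otimes>\<^bsub>G\<^esub> v)"
      using bF bT by (intro bexI[of _ "inv\<^bsub>G\<^esub> t"] bexI[of _ b]) auto
  next
    fix A :: "'a poly ^ 3 ^ 3" assume A: "A \<in> carrier G" "A \<notin> Tgrp"
    then have SU: "A \<in> SU" by simp
    then have nz: "A $ 3 $ 1 \<noteq> 0" using A(2) Tgrp_iff[OF ch] by blast
    then obtain t where "t \<in> Tgrp"
      "(t ** A) $ 1 $ 1 = 0 \<or> degree ((t ** A) $ 1 $ 1) < degree (A $ 3 $ 1)"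
      using descent_step[OF ch SU] by metis
    then show "\<exists>t\<in>Tgrp. (if (weyl \<otimes>\<^bsub>G\<^esub> (t \<otimes>\<^bsub>G\<^esub> A)) $ 3 $ 1 = 0 then 0
        else Suc (degree ((weyl \<otimes>\<^bsub>G\<^esub> (t \<otimes>\<^bsub>G\<^esub> A)) $ 3 $ 1)))
      < (if A $ 3 $ 1 = 0 then 0 else Suc (degree (A $ 3 $ 1)))"
      using nz by (intro bexI[of _ t]) auto
  next
    show "dominated \<inter> Tgrp = {}" by (auto simp: dominated_def Tgrp_def upper_triangular3_def)
  qed (use FG TG wF weyl_Tgrp_dominated[OF ch] weyl_Tgrp_dominated_step[OF ch] in auto)
  show ?thesis using amalgamated_sum by (simp add: G_def)
qed

theorem theorem2p4:
  assumes "CHAR('a::field) \<noteq> 2"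
  shows "subgroup (SU :: ('a poly ^ 3 ^ 3) set) SL3
    \<and> const_mat \<in> iso (SL3\<lparr>carrier := (SO3 :: ('a ^ 3 ^ 3) set)\<rparr>) (SL3\<lparr>carrier := Fgrp\<rparr>)
    \<and> (\<lambda>c. [:c:]) ` (UNIV - {0 :: 'a}) = {p. p dvd 1}
    \<and> (Tgrp :: ('a poly ^ 3 ^ 3) set) = {tri_mat c x y | c x y. c \<noteq> 0 \<and> Nm x + Tr y = 0}
    \<and> amalgamated_sum (SL3\<lparr>carrier := (SU :: ('a poly ^ 3 ^ 3) set)\<rparr>) Fgrp Tgrp TYPE('h)"
proof (intro conjI)
  show "(\<lambda>c. [:c:]) ` (UNIV - {0 :: 'a}) = {p. p dvd 1}"
    by (auto simp: is_unit_poly_iff image_iff dvd_field_iff)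
qed (rule SU_subgroup const_mat_iso[OF assms] Tgrp_eq[OF assms] SU_amalgamated_sum[OF assms])+

end
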